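(* Let $(M,g,J)$ be an almost Hermitian manifold. Let $\nabla^g$ be the Levi-Civita connection in the Lie algebroid $(TM,\mathrm{Id}_{TM},[\cdot,\cdot])$ and let $\nabla^{J,g}$ be the Levi-Civita connection in the skew-symmetric algebroid $(TM,J,[\![\cdot,\cdot]\!]^J)$, both metric with respect to $g$. If $\langle X:Y\rangle=\nabla^g_XY+\nabla^g_YX$ and $\langle X:Y\rangle^J=\nabla^{J,g}_XY+\nabla^{J,g}_YX$ for $X,Y\in\Gamma(TM)$, then $$\langle X:Y\rangle^J=\langle JX:Y\rangle+\langle X:JY\rangle+\sharp\big(\langle X:Y\rangle^\flat\circ J\big)$$ for all $X,Y\in\Gamma(TM)$.
   Context: An almost Hermitian manifold $(M,g,J)$ is a $2n$-dimensional Riemannian manifold $(M,g)$ with an orthogonal almost complex structure $J:TM\to TM$. $[\cdot,\cdot]$ is the Lie bracket of vector fields and $$[\![X,Y]\!]^J=[JX,Y]+[X,JY]-J[X,Y].$$ A skew-symmetric algebroid $(A,\varrho_A,[\cdot,\cdot]_A)$ over $M$ is a vector bundle $A\to M$ with a bundle homomorphism $\varrho_A:A\to TM$ over the identity (anchor) and an $\mathbb{R}$-bilinear skew-symmetric bracket on $\Gamma(A)$ with $[X,fY]_A=f[X,Y]_A+(\varrho_A\circ X)(f)Y$; $(TM,J,[\![\cdot,\cdot]\!]^J)$ is one, with anchor $J$. An $A$-connection in $A$ is an $\mathbb{R}$-bilinear map $\nabla:\Gamma(A)\times\Gamma(A)\to\Gamma(A)$ with $\nabla_{fX}Y=f\nabla_XY$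 and $\nabla_X(fY)=f\nabla_XY+(\varrho_A\circ X)(f)Y$. The Levi-Civita connection of the algebroid with respect to a metric $g$ in $A$ is the unique $A$-connection with $\nabla_XY-\nabla_YX=[X,Y]_A$ and $(\varrho_A\circ X)(g(Y,Z))=g(\nabla_XY,Z)+g(Y,\nabla_XZ)$. Here $X^\flat=g(X,\cdot)$ and $\sharp:T^*M\to TM$ is given by $g(\sharp(\omega),X)=\omega(X)$. *)

theory Defs
  imports "HOL-Analysis.Analysis" "HOL-Library.Function_Algebras"
begin

section \<open>Smooth manifolds\<close>

fun k_smooth_on :: "nat \<Rightarrow> 'e::real_normed_vector set \<Rightarrow> ('e \<Rightarrow> 'f::real_normed_vector) \<Rightarrow> bool" where
  "k_smooth_on 0 S f \<longleftrightarrow> continuous_on S f"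
| "k_smooth_on (Suc k) S f \<longleftrightarrow>
     (\<forall>x\<in>S. f differentiable (at x)) \<and> (\<forall>v. k_smooth_on k S (\<lambda>x. frechet_derivative f (at x) v))"

text \<open>\<open>S\<close> is always an open subset of a finite-dimensional space below, so this is \<open>C\<^sup>\<infinity>\<close>.\<close>

definition smooth_on :: "'e::real_normed_vector set \<Rightarrow> ('e \<Rightarrow> 'f::real_normed_vector) \<Rightarrow> bool" where
  "smooth_on S f \<longleftrightarrow> (\<forall>k. k_smooth_on k S f)"

text \<open>The underlying set of the manifold \<open>M\<close> is the whole type \<open>'a\<close>, and the chart
  \<open>(U, \<phi>)\<close> is the restriction of \<open>\<phi>\<close> to \<open>U\<close>; values of \<open>\<phi>\<close> outside \<open>U\<close> are irrelevant.\<close>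

type_synonym ('a, 'n) atlas = "('a set \<times> ('a \<Rightarrow> real ^ 'n)) set"

definition smooth_manifold ::
    "('a::{t2_space, second_countable_topology}, 'n::finite) atlas \<Rightarrow> bool" where
  "smooth_manifold A \<longleftrightarrow>
     (\<Union>(U, \<phi>)\<in>A. U) = UNIV \<and>
     (\<forall>(U, \<phi>)\<in>A. open U \<and> open (\<phi> ` U) \<and> homeomorphism U (\<phi> ` U) \<phi> (inv_into U \<phi>)) \<and>
     (\<forall>(U, \<phi>)\<in>A. \<forall>(V, \<psi>)\<in>A. smooth_on (\<phi> ` (U \<inter> V)) (\<psi> \<circ> inv_into U \<phi>))"

definition smooth_fun :: "('a, 'n::finite) atlas \<Rightarrow> ('a \<Rightarrow> real) \<Rightarrow> bool" where
  "smooth_fun A f \<longleftrightarrow> (\<forall>(U, \<phi>)\<in>A. smooth_on (\<phi> ` U) (f \<circ> inv_into U \<phi>))"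

section \<open>Tangent vectors and vector fields\<close>

text \<open>A tangent vector at \<open>p\<close> is a derivation at \<open>p\<close> of the algebra of smooth functions. It is a
  functional on all functions, with the dummy value \<open>0\<close> on the non-smooth ones, so that
  equality in HOL is equality of derivations. Vectors, vector fields and functions are
  added and subtracted pointwise.\<close>

type_synonym 'a tvec = "('a \<Rightarrow> real) \<Rightarrow> real"
type_synonym 'a vfield = "'a \<Rightarrow> 'a tvec"

definition tangent_space :: "('a, 'n::finite) atlas \<Rightarrow> 'a \<Rightarrow> 'a tvec set" where
  "tangent_space A p = {v.
     (\<forall>f. \<not> smooth_fun A f \<longrightarrow> v f = 0) \<and>
     (\<forall>f h. smooth_fun A f \<longrightarrow> smooth_fun A h \<longrightarrow> v (f + h) = v f + v h) \<and>
     (\<forall>c f. smooth_fun A f \<longrightarrow> v (\<lambda>q. c * f q) = c * v f) \<and>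
     (\<forall>f h. smooth_fun A f \<longrightarrow> smooth_fun A h \<longrightarrow> v (f * h) = f p * v h + h p * v f)}"

definition tscale :: "real \<Rightarrow> 'a tvec \<Rightarrow> 'a tvec" where
  "tscale c v = (\<lambda>f. c * v f)"

definition apply_field :: "'a vfield \<Rightarrow> ('a \<Rightarrow> real) \<Rightarrow> 'a \<Rightarrow> real" where
  "apply_field X f = (\<lambda>p. X p f)"

definition vector_fields :: "('a, 'n::finite) atlas \<Rightarrow> 'a vfield set" where
  "vector_fields A = {X. (\<forall>p. X p \<in> tangent_space A p) \<and>
     (\<forall>f. smooth_fun A f \<longrightarrow> smooth_fun A (apply_field X f))}"

definition fscale :: "('a \<Rightarrow> real) \<Rightarrow> 'a vfield \<Rightarrow> 'a vfield" where
  "fscale f X = (\<lambda>p. tscale (f p) (X p))"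

text \<open>For vector fields \<open>X\<close>, \<open>Y\<close> this respects the convention for non-smooth \<open>f\<close>, because
  both \<open>apply_field X f\<close> and \<open>apply_field Y f\<close> are then the zero function.\<close>

definition lie_bracket :: "'a vfield \<Rightarrow> 'a vfield \<Rightarrow> 'a vfield" where
  "lie_bracket X Y = (\<lambda>p f. X p (apply_field Y f) - Y p (apply_field X f))"

section \<open>Bundle endomorphisms, metrics, almost Hermitian structures\<close>

type_synonym 'a bundle_map = "'a \<Rightarrow> 'a tvec \<Rightarrow> 'a tvec"

definition map_field :: "'a bundle_map \<Rightarrow> 'a vfield \<Rightarrow> 'a vfield" where
  "map_field F X = (\<lambda>p. F p (X p))"

definition bundle_endo :: "('a, 'n::finite) atlas \<Rightarrow> 'a bundle_map \<Rightarrow> bool" where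
  "bundle_endo A F \<longleftrightarrow>
     (\<forall>p. \<forall>v\<in>tangent_space A p. F p v \<in> tangent_space A p) \<and>
     (\<forall>p. \<forall>v\<in>tangent_space A p. \<forall>w\<in>tangent_space A p. F p (v + w) = F p v + F p w) \<and>
     (\<forall>p c. \<forall>v\<in>tangent_space A p. F p (tscale c v) = tscale c (F p v)) \<and>
     (\<forall>X\<in>vector_fields A. map_field F X \<in> vector_fields A)"

type_synonym 'a metric_tensor = "'a \<Rightarrow> 'a tvec \<Rightarrow> 'a tvec \<Rightarrow> real"

definition inner_field :: "'a metric_tensor \<Rightarrow> 'a vfield \<Rightarrow> 'a vfield \<Rightarrow> 'a \<Rightarrow> real" where
  "inner_field g X Y = (\<lambda>p. g p (X p) (Y p))"

definition riemannian_metric :: "('a, 'n::finite) atlas \<Rightarrow> 'a metric_tensor \<Rightarrow> bool" where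
  "riemannian_metric A g \<longleftrightarrow>
     (\<forall>p. \<forall>u\<in>tangent_space A p. \<forall>v\<in>tangent_space A p. \<forall>w\<in>tangent_space A p.
        g p (u + v) w = g p u w + g p v w) \<and>
     (\<forall>p c. \<forall>v\<in>tangent_space A p. \<forall>w\<in>tangent_space A p. g p (tscale c v) w = c * g p v w) \<and>
     (\<forall>p. \<forall>v\<in>tangent_space A p. \<forall>w\<in>tangent_space A p. g p v w = g p w v) \<and>
     (\<forall>p. \<forall>v\<in>tangent_space A p. v \<noteq> 0 \<longrightarrow> g p v v > 0) \<and>
     (\<forall>X\<in>vector_fields A. \<forall>Y\<in>vector_fields A. smooth_fun A (inner_field g X Y))"

definition almost_complex :: "('a, 'n::finite) atlas \<Rightarrow> 'a bundle_map \<Rightarrow> bool" where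
  "almost_complex A J \<longleftrightarrow> bundle_endo A J \<and>
     (\<forall>p. \<forall>v\<in>tangent_space A p. J p (J p v) = - v)"

definition almost_hermitian_manifold :: "nat \<Rightarrow>
    ('a::{t2_space, second_countable_topology}, 'n::finite) atlas \<Rightarrow>
    'a metric_tensor \<Rightarrow> 'a bundle_map \<Rightarrow> bool" where
  "almost_hermitian_manifold n A g J \<longleftrightarrow>
     smooth_manifold A \<and> CARD('n) = 2 * n \<and> riemannian_metric A g \<and> almost_complex A J \<and>
     (\<forall>p. \<forall>v\<in>tangent_space A p. \<forall>w\<in>tangent_space A p. g p (J p v) (J p w) = g p v w)"

section \<open>Skew-symmetric algebroids on the tangent bundle\<close>

type_synonym 'a field_op = "'a vfield \<Rightarrow> 'a vfield \<Rightarrow> 'a vfield"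

definition real_bilinear_op :: "('a, 'n::finite) atlas \<Rightarrow> 'a field_op \<Rightarrow> bool" where
  "real_bilinear_op A B \<longleftrightarrow>
     (\<forall>X\<in>vector_fields A. \<forall>Y\<in>vector_fields A. B X Y \<in> vector_fields A) \<and>
     (\<forall>X\<in>vector_fields A. \<forall>Y\<in>vector_fields A. \<forall>Z\<in>vector_fields A.
        B (X + Y) Z = B X Z + B Y Z \<and> B Z (X + Y) = B Z X + B Z Y) \<and>
     (\<forall>c. \<forall>X\<in>vector_fields A. \<forall>Y\<in>vector_fields A.
        B (fscale (\<lambda>_. c) X) Y = fscale (\<lambda>_. c) (B X Y) \<and>
        B X (fscale (\<lambda>_. c) Y) = fscale (\<lambda>_. c) (B X Y))"

text \<open>The structure \<open>(TM, \<rho>, br)\<close>: here the vector bundle of the algebroid is \<open>TM\<close> itself.\<close>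

definition skew_algebroid ::
    "('a, 'n::finite) atlas \<Rightarrow> 'a bundle_map \<Rightarrow> 'a field_op \<Rightarrow> bool" where
  "skew_algebroid A \<rho> br \<longleftrightarrow> bundle_endo A \<rho> \<and> real_bilinear_op A br \<and>
     (\<forall>X\<in>vector_fields A. \<forall>Y\<in>vector_fields A. br X Y = - br Y X) \<and>
     (\<forall>f. smooth_fun A f \<longrightarrow> (\<forall>X\<in>vector_fields A. \<forall>Y\<in>vector_fields A.
        br X (fscale f Y) = fscale f (br X Y) + fscale (apply_field (map_field \<rho> X) f) Y))"

definition algebroid_connection ::
    "('a, 'n::finite) atlas \<Rightarrow> 'a bundle_map \<Rightarrow> 'a field_op \<Rightarrow> bool" where
  "algebroid_connection A \<rho> nab \<longleftrightarrow> real_bilinear_op A nab \<and>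
     (\<forall>f. smooth_fun A f \<longrightarrow> (\<forall>X\<in>vector_fields A. \<forall>Y\<in>vector_fields A.
        nab (fscale f X) Y = fscale f (nab X Y) \<and>
        nab X (fscale f Y) = fscale f (nab X Y) + fscale (apply_field (map_field \<rho> X) f) Y))"

text \<open>Uniqueness of the Levi-Civita connection (on vector fields) is
  \<open>levi_civita_unique\<close> below.\<close>

definition levi_civita :: "('a, 'n::finite) atlas \<Rightarrow> 'a metric_tensor \<Rightarrow>
    'a bundle_map \<Rightarrow> 'a field_op \<Rightarrow> 'a field_op \<Rightarrow> bool" where
  "levi_civita A g \<rho> br nab \<longleftrightarrow> algebroid_connection A \<rho> nab \<and>
     (\<forall>X\<in>vector_fields A. \<forall>Y\<in>vector_fields A. nab X Y - nab Y X = br X Y) \<and>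
     (\<forall>X\<in>vector_fields A. \<forall>Y\<in>vector_fields A. \<forall>Z\<in>vector_fields A.
        apply_field (map_field \<rho> X) (inner_field g Y Z) =
          inner_field g (nab X Y) Z + inner_field g Y (nab X Z))"

definition id_anchor :: "'a bundle_map" where
  "id_anchor = (\<lambda>p v. v)"

definition J_bracket :: "'a bundle_map \<Rightarrow> 'a field_op" where
  "J_bracket J X Y = lie_bracket (map_field J X) Y + lie_bracket X (map_field J Y)
     - map_field J (lie_bracket X Y)"

definition sym_product :: "'a field_op \<Rightarrow> 'a field_op" where
  "sym_product nab X Y = nab X Y + nab Y X"

section \<open>Musical maps\<close>

type_synonym 'a one_form = "'a \<Rightarrow> 'a tvec \<Rightarrow> real"

definition flat :: "'a metric_tensor \<Rightarrow> 'a vfield \<Rightarrow> 'a one_form" where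
  "flat g X = (\<lambda>p v. g p (X p) v)"

definition form_comp :: "'a one_form \<Rightarrow> 'a bundle_map \<Rightarrow> 'a one_form" where
  "form_comp \<omega> F = (\<lambda>p. \<omega> p \<circ> F p)"

definition sharp :: "('a, 'n::finite) atlas \<Rightarrow> 'a metric_tensor \<Rightarrow> 'a one_form \<Rightarrow> 'a vfield" where
  "sharp A g \<omega> = (\<lambda>p. THE v. v \<in> tangent_space A p \<and> (\<forall>w\<in>tangent_space A p. g p v w = \<omega> p w))"

section \<open>The two algebroid structures on \<open>TM\<close> and uniqueness of the Levi-Civita connection\<close>

lemma k_smooth_on_cong:
  assumes "open S" "\<And>x. x \<in> S \<Longrightarrow> f x = h x" "k_smooth_on k S f"
  shows "k_smooth_on k S h"
  using assms(2,3)
proof (induction k arbitrary: f h)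
  case 0
  then show ?case using continuous_on_cong[of S S f h] by simp
next
  case (Suc k)
  have D: "(h has_derivative frechet_derivative f (at x)) (at x)" if "x \<in> S" for x
  proof -
    have "(f has_derivative frechet_derivative f (at x)) (at x)"
      using Suc.prems(2) that by (simp add: frechet_derivative_works)
    then show ?thesis
      by (rule has_derivative_transform_within_open[OF _ assms(1) that]) (use Suc.prems(1) in auto)
  qed
  have eq: "frechet_derivative f (at x) = frechet_derivative h (at x)" if "x \<in> S" for x
    using frechet_derivative_at[OF D[OF that]] .
  have "k_smooth_on k S (\<lambda>x. frechet_derivative h (at x) v)" for v
    by (rule Suc.IH[of "\<lambda>x. frechet_derivative f (at x) v"]) (use eq Suc.prems(2) in auto)
  moreover have "\<forall>x\<in>S. h differentiable (at x)" using D differentiableI by blast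
  ultimately show ?case by simp
qed

lemma k_smooth_on_Suc_D: "k_smooth_on (Suc k) S f \<Longrightarrow> k_smooth_on k S f"
proof (induction k arbitrary: f)
  case 0
  then show ?case
    by (auto intro!: continuous_at_imp_continuous_on differentiable_imp_continuous_within)
next
  case (Suc k)
  then show ?case by (metis k_smooth_on.simps(2))
qed

lemma k_smooth_on_const: "k_smooth_on k S (\<lambda>_. c)"
  by (induction k arbitrary: c) (auto simp: frechet_derivative_const)

lemma k_smooth_on_add:
  assumes "open S" "k_smooth_on k S f" "k_smooth_on k S h"
  shows "k_smooth_on k S (\<lambda>x. f x + h x)"
  using assms(2,3)
proof (induction k arbitrary: f h)
  case 0
  then show ?case by (auto intro: continuous_on_add)
next
  case (Suc k)
  have D: "((\<lambda>x. f x + h x) has_derivative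
      (\<lambda>v. frechet_derivative f (at x) v + frechet_derivative h (at x) v)) (at x)"
    if "x \<in> S" for x
    using Suc.prems that
    by (intro has_derivative_add) (auto simp: frechet_derivative_works[symmetric])
  have "k_smooth_on k S (\<lambda>x. frechet_derivative (\<lambda>x. f x + h x) (at x) v)" for v
  proof (rule k_smooth_on_cong[OF assms(1)])
    show "k_smooth_on k S (\<lambda>x. frechet_derivative f (at x) v + frechet_derivative h (at x) v)"
      using Suc by auto
    show "frechet_derivative f (at x) v + frechet_derivative h (at x) v
        = frechet_derivative (\<lambda>x. f x + h x) (at x) v" if "x \<in> S" for x
      using fun_cong[OF frechet_derivative_at[OF D[OF that]], of v] .
  qed
  then show ?case using Suc.prems by auto
qed

lemma k_smooth_on_mult:
  fixes f h :: "'e::real_normed_vector \<Rightarrow> real"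
  assumes "open S" "k_smooth_on k S f" "k_smooth_on k S h"
  shows "k_smooth_on k S (\<lambda>x. f x * h x)"
  using assms(2,3)
proof (induction k arbitrary: f h)
  case 0
  then show ?case by (auto intro: continuous_on_mult)
next
  case (Suc k)
  have D: "((\<lambda>x. f x * h x) has_derivative
      (\<lambda>v. f x * frechet_derivative h (at x) v + frechet_derivative f (at x) v * h x)) (at x)"
    if "x \<in> S" for x
    using Suc.prems that
    by (intro has_derivative_mult) (auto simp: frechet_derivative_works[symmetric])
  have fh: "k_smooth_on k S f" "k_smooth_on k S h"
    using Suc.prems k_smooth_on_Suc_D by blast+
  have "k_smooth_on k S (\<lambda>x. frechet_derivative (\<lambda>x. f x * h x) (at x) v)" for v
  proof (rule k_smooth_on_cong[OF assms(1)])
    show "k_smooth_on k S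
        (\<lambda>x. f x * frechet_derivative h (at x) v + frechet_derivative f (at x) v * h x)"
      using Suc fh by (intro k_smooth_on_add[OF assms(1)] Suc.IH) auto
    show "f x * frechet_derivative h (at x) v + frechet_derivative f (at x) v * h x
        = frechet_derivative (\<lambda>x. f x * h x) (at x) v" if "x \<in> S" for x
      using fun_cong[OF frechet_derivative_at[OF D[OF that]], of v] .
  qed
  moreover have "\<forall>x\<in>S. (\<lambda>x. f x * h x) differentiable (at x)" using D differentiableI by blast
  ultimately show ?case by simp
qed

lemma chart_open: "smooth_manifold A \<Longrightarrow> (U, \<phi>) \<in> A \<Longrightarrow> open (\<phi> ` U)"
  by (auto simp: smooth_manifold_def)

lemma smooth_fun_const: "smooth_fun A (\<lambda>_. c)"
  by (auto simp: smooth_fun_def smooth_on_def comp_def k_smooth_on_const)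

lemma smooth_fun_add:
  assumes "smooth_manifold A" "smooth_fun A f" "smooth_fun A h"
  shows "smooth_fun A (f + h)"
  using assms chart_open[OF assms(1)]
  by (fastforce simp: smooth_fun_def smooth_on_def comp_def intro!: k_smooth_on_add)

lemma smooth_fun_mult:
  assumes "smooth_manifold A" "smooth_fun A f" "smooth_fun A h"
  shows "smooth_fun A (f * h)"
  using assms chart_open[OF assms(1)]
  by (fastforce simp: smooth_fun_def smooth_on_def comp_def intro!: k_smooth_on_mult)

lemma smooth_fun_scale:
  assumes "smooth_manifold A" "smooth_fun A f"
  shows "smooth_fun A (\<lambda>q. c * f q)"
  using smooth_fun_mult[OF assms(1) smooth_fun_const[of A c] assms(2)] by (simp add: times_fun_def)

lemma smooth_fun_minus:
  assumes "smooth_manifold A" "smooth_fun A f"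
  shows "smooth_fun A (- f)"
  using smooth_fun_scale[OF assms, of "-1"] by (simp add: fun_Compl_def)

lemma smooth_fun_diff:
  assumes "smooth_manifold A" "smooth_fun A f" "smooth_fun A h"
  shows "smooth_fun A (f - h)"
  using smooth_fun_add[OF assms(1,2) smooth_fun_minus[OF assms(1,3)]] by simp

lemma tangent_add: "v \<in> tangent_space A p \<Longrightarrow> w \<in> tangent_space A p \<Longrightarrow> v + w \<in> tangent_space A p"
  by (simp add: tangent_space_def algebra_simps)

lemma tangent_scale: "v \<in> tangent_space A p \<Longrightarrow> tscale c v \<in> tangent_space A p"
  by (simp add: tangent_space_def tscale_def algebra_simps)

lemma minus_eq_tscale: "- v = tscale (-1) v"
  by (simp add: tscale_def fun_eq_iff)

lemma tangent_minus: "v \<in> tangent_space A p \<Longrightarrow> - v \<in> tangent_space A p"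
  by (simp only: minus_eq_tscale tangent_scale)

lemma tangent_diff: "v \<in> tangent_space A p \<Longrightarrow> w \<in> tangent_space A p \<Longrightarrow> v - w \<in> tangent_space A p"
  using tangent_add[of v A p "- w"] tangent_minus[of w A p] by simp

lemma vector_fields_add:
  assumes "smooth_manifold A" "X \<in> vector_fields A" "Y \<in> vector_fields A"
  shows "X + Y \<in> vector_fields A"
proof -
  have "apply_field (X + Y) f = apply_field X f + apply_field Y f" for f
    by (simp add: apply_field_def fun_eq_iff)
  then show ?thesis
    using assms by (auto simp: vector_fields_def intro: tangent_add smooth_fun_add)
qed

lemma vector_fields_fscale:
  assumes "smooth_manifold A" "X \<in> vector_fields A" "smooth_fun A f"
  shows "fscale f X \<in> vector_fields A"
proof -
  have "apply_field (fscale f X) h = f * apply_field X h" for h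
    by (simp add: apply_field_def fscale_def tscale_def fun_eq_iff)
  then show ?thesis
    using assms by (auto simp: vector_fields_def fscale_def intro: tangent_scale smooth_fun_mult)
qed

lemma minus_eq_fscale: "- X = fscale (\<lambda>_. -1) X"
  by (simp add: fscale_def tscale_def fun_eq_iff)

lemma vector_fields_minus:
  assumes "smooth_manifold A" "X \<in> vector_fields A"
  shows "- X \<in> vector_fields A"
  by (simp only: minus_eq_fscale vector_fields_fscale[OF assms smooth_fun_const])

lemma vector_fields_diff:
  assumes "smooth_manifold A" "X \<in> vector_fields A" "Y \<in> vector_fields A"
  shows "X - Y \<in> vector_fields A"
  using vector_fields_add[OF assms(1,2) vector_fields_minus[OF assms(1,3)]] by simp

lemma vector_fieldsD:
  assumes "X \<in> vector_fields A"
  shows "X p \<in> tangent_space A p" "smooth_fun A f \<Longrightarrow> smooth_fun A (apply_field X f)"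
    "\<not> smooth_fun A f \<Longrightarrow> X p f = 0"
    "smooth_fun A f \<Longrightarrow> smooth_fun A h \<Longrightarrow> X p (f + h) = X p f + X p h"
    "smooth_fun A f \<Longrightarrow> X p (\<lambda>q. c * f q) = c * X p f"
    "smooth_fun A f \<Longrightarrow> smooth_fun A h \<Longrightarrow> X p (f * h) = f p * X p h + h p * X p f"
  using assms by (auto simp: vector_fields_def tangent_space_def)

lemma apply_field_simps:
  assumes "X \<in> vector_fields A"
  shows "smooth_fun A f \<Longrightarrow> smooth_fun A h \<Longrightarrow>
      apply_field X (f + h) = apply_field X f + apply_field X h"
    "smooth_fun A f \<Longrightarrow> apply_field X (\<lambda>q. c * f q) = (\<lambda>q. c * apply_field X f q)"
    "smooth_fun A f \<Longrightarrow> smooth_fun A h \<Longrightarrow>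
      apply_field X (f * h) = f * apply_field X h + h * apply_field X f"
  using assms by (auto simp: apply_field_def vector_fieldsD fun_eq_iff)

lemma field_zero:
  assumes "X \<in> vector_fields A"
  shows "X p (\<lambda>_. 0) = 0"
  using vector_fieldsD(5)[OF assms smooth_fun_const[of A 0], of p 0] by simp

lemma lie_bracket_vector_fields:
  assumes M: "smooth_manifold A" and X: "X \<in> vector_fields A" and Y: "Y \<in> vector_fields A"
  shows "lie_bracket X Y \<in> vector_fields A"
proof -
  note XY = vector_fieldsD[OF X] vector_fieldsD[OF Y] apply_field_simps[OF X] apply_field_simps[OF Y]
    smooth_fun_add[OF M] smooth_fun_mult[OF M] smooth_fun_scale[OF M]
  have "lie_bracket X Y p f = 0" if "\<not> smooth_fun A f" for p f
  proof -
    have "apply_field X f = (\<lambda>_. 0)" "apply_field Y f = (\<lambda>_. 0)"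
      using that X Y by (auto simp: apply_field_def vector_fieldsD fun_eq_iff)
    then show ?thesis using X Y by (simp add: lie_bracket_def field_zero)
  qed
  moreover have "lie_bracket X Y p (f * h) = f p * lie_bracket X Y p h + h p * lie_bracket X Y p f"
    if "smooth_fun A f" "smooth_fun A h" for p f h
    using that by (simp add: lie_bracket_def XY) (simp add: apply_field_def algebra_simps)
  ultimately have "lie_bracket X Y p \<in> tangent_space A p" for p
    unfolding tangent_space_def by (auto simp: lie_bracket_def XY algebra_simps)
  moreover have "apply_field (lie_bracket X Y) f =
      apply_field X (apply_field Y f) - apply_field Y (apply_field X f)" for f
    by (simp add: apply_field_def lie_bracket_def fun_eq_iff)
  ultimately show ?thesis
    unfolding vector_fields_def by (auto simp: XY intro!: smooth_fun_diff[OF M])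
qed

lemma lie_bracket_add:
  assumes M: "smooth_manifold A" and X: "X \<in> vector_fields A" and Y: "Y \<in> vector_fields A"
    and Z: "Z \<in> vector_fields A"
  shows "lie_bracket (X + Y) Z = lie_bracket X Z + lie_bracket Y Z"
    "lie_bracket Z (X + Y) = lie_bracket Z X + lie_bracket Z Y"
proof -
  have eq: "apply_field (X + Y) f = apply_field X f + apply_field Y f" for f
    by (simp add: apply_field_def fun_eq_iff)
  have "Z p (apply_field X f + apply_field Y f) = Z p (apply_field X f) + Z p (apply_field Y f)"
    for p f
  proof (cases "smooth_fun A f")
    case True
    then show ?thesis using X Y Z by (simp add: vector_fieldsD)
  next
    case False
    then have "apply_field X f = (\<lambda>_. 0)" "apply_field Y f = (\<lambda>_. 0)"
      using X Y by (auto simp: apply_field_def vector_fieldsD fun_eq_iff)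
    then show ?thesis using field_zero[OF Z] by (simp add: plus_fun_def)
  qed
  then show "lie_bracket (X + Y) Z = lie_bracket X Z + lie_bracket Y Z"
    "lie_bracket Z (X + Y) = lie_bracket Z X + lie_bracket Z Y"
    by (simp_all add: lie_bracket_def fun_eq_iff eq)
qed

lemma lie_bracket_skew: "lie_bracket X Y = - lie_bracket Y X"
  by (simp add: lie_bracket_def fun_eq_iff)

lemma lie_bracket_fscale:
  assumes M: "smooth_manifold A" and X: "X \<in> vector_fields A" and Y: "Y \<in> vector_fields A"
    and f: "smooth_fun A f"
  shows "lie_bracket X (fscale f Y) = fscale f (lie_bracket X Y) + fscale (apply_field X f) Y"
proof -
  have eq: "apply_field (fscale f Y) h = f * apply_field Y h" for h
    by (simp add: apply_field_def fscale_def tscale_def fun_eq_iff)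
  have "X p (f * apply_field Y h) = f p * X p (apply_field Y h) + Y p h * X p f" for p h
  proof (cases "smooth_fun A h")
    case True
    then show ?thesis using X Y f by (simp add: vector_fieldsD) (simp add: apply_field_def)
  next
    case False
    then have "apply_field Y h = (\<lambda>_. 0)"
      using Y by (auto simp: apply_field_def vector_fieldsD fun_eq_iff)
    then show ?thesis
      using False X Y by (simp add: field_zero vector_fieldsD times_fun_def)
  qed
  then show ?thesis
    by (simp add: lie_bracket_def fun_eq_iff eq)
       (simp add: fscale_def tscale_def apply_field_def algebra_simps)
qed

lemma apply_field_const:
  assumes "X \<in> vector_fields A"
  shows "apply_field X (\<lambda>_. c) = (\<lambda>_. 0)"
proof -
  have "X p (\<lambda>_. c) = 0" for p
  proof -
    let ?one = "\<lambda>_. 1"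
    have "X p (?one * ?one) = X p ?one + X p ?one"
      using vector_fieldsD(6)[OF assms smooth_fun_const smooth_fun_const, of p 1 1] by simp
    then have "X p ?one = 0" by (simp add: times_fun_def)
    then show ?thesis
      using vector_fieldsD(5)[OF assms smooth_fun_const, of p c 1] by simp
  qed
  then show ?thesis by (simp add: apply_field_def)
qed

lemma skew_algebroidI:
  assumes M: "smooth_manifold A" and "bundle_endo A \<rho>"
    and cl: "\<And>X Y. X \<in> vector_fields A \<Longrightarrow> Y \<in> vector_fields A \<Longrightarrow> br X Y \<in> vector_fields A"
    and add: "\<And>X Y Z. X \<in> vector_fields A \<Longrightarrow> Y \<in> vector_fields A \<Longrightarrow> Z \<in> vector_fields A \<Longrightarrow>
      br Z (X + Y) = br Z X + br Z Y"
    and skew: "\<And>X Y. X \<in> vector_fields A \<Longrightarrow> Y \<in> vector_fields A \<Longrightarrow> br X Y = - br Y X"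
    and leib: "\<And>f X Y. smooth_fun A f \<Longrightarrow> X \<in> vector_fields A \<Longrightarrow> Y \<in> vector_fields A \<Longrightarrow>
      br X (fscale f Y) = fscale f (br X Y) + fscale (apply_field (map_field \<rho> X) f) Y"
  shows "skew_algebroid A \<rho> br"
proof -
  have mf: "map_field \<rho> X \<in> vector_fields A" if "X \<in> vector_fields A" for X
    using that assms(2) by (simp add: bundle_endo_def)
  have sc: "br X (fscale (\<lambda>_. c) Y) = fscale (\<lambda>_. c) (br X Y)"
    if "X \<in> vector_fields A" "Y \<in> vector_fields A" for c X Y
    using leib[OF smooth_fun_const that] apply_field_const[OF mf[OF that(1)]]
    by (simp add: fscale_def tscale_def fun_eq_iff)
  have sc': "br (fscale (\<lambda>_. c) X) Y = fscale (\<lambda>_. c) (br X Y)"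
    if "X \<in> vector_fields A" "Y \<in> vector_fields A" for c X Y
  proof -
    have "br (fscale (\<lambda>_. c) X) Y = - br Y (fscale (\<lambda>_. c) X)"
      by (rule skew) (use that M in \<open>auto intro: vector_fields_fscale smooth_fun_const\<close>)
    also have "\<dots> = fscale (\<lambda>_. c) (- br Y X)"
      using sc[OF that(2,1)] by (simp add: fscale_def tscale_def fun_eq_iff)
    also have "- br Y X = br X Y" using skew[OF that] by simp
    finally show ?thesis .
  qed
  have add': "br (X + Y) Z = br X Z + br Y Z"
    if "X \<in> vector_fields A" "Y \<in> vector_fields A" "Z \<in> vector_fields A" for X Y Z
    using skew[OF vector_fields_add[OF M that(1,2)] that(3)] add[OF that]
      skew[OF that(1,3)] skew[OF that(2,3)] by simp
  have "real_bilinear_op A br"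
    unfolding real_bilinear_op_def by (simp add: cl add add' sc sc')
  then show ?thesis
    unfolding skew_algebroid_def
    by (intro conjI assms(2)) (assumption, (intro ballI, rule skew; assumption), simp add: leib)
qed

lemma skew_algebroid_lie:
  assumes "smooth_manifold A"
  shows "skew_algebroid A id_anchor lie_bracket"
proof (rule skew_algebroidI[OF assms])
  have eq: "map_field id_anchor X = X" for X :: "'a vfield"
    by (simp add: map_field_def id_anchor_def)
  show "bundle_endo A id_anchor"
    unfolding bundle_endo_def eq by (simp add: id_anchor_def)
  show "lie_bracket X (fscale f Y) = fscale f (lie_bracket X Y)
      + fscale (apply_field (map_field id_anchor X) f) Y"
    if "smooth_fun A f" "X \<in> vector_fields A" "Y \<in> vector_fields A" for f X Y
    unfolding eq by (rule lie_bracket_fscale[OF assms that(2,3,1)])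
qed (fact lie_bracket_vector_fields[OF assms] lie_bracket_add(2)[OF assms] | rule lie_bracket_skew)+

lemma skew_algebroid_J:
  assumes M: "smooth_manifold A" and J: "almost_complex A J"
  shows "skew_algebroid A J (J_bracket J)"
proof (rule skew_algebroidI[OF M])
  show bJ: "bundle_endo A J" using J by (simp add: almost_complex_def)
  have Jf: "map_field J X \<in> vector_fields A" if "X \<in> vector_fields A" for X
    using bJ that by (simp add: bundle_endo_def)
  have Jadd: "map_field J (X + Y) = map_field J X + map_field J Y"
    if "X \<in> vector_fields A" "Y \<in> vector_fields A" for X Y
    using bJ that by (simp add: bundle_endo_def map_field_def fun_eq_iff vector_fieldsD)
  have Jsc: "map_field J (fscale f X) = fscale f (map_field J X)"
    if "X \<in> vector_fields A" for f X
    using bJ that by (simp add: bundle_endo_def map_field_def fscale_def fun_eq_iff vector_fieldsD)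
  note lv = lie_bracket_vector_fields[OF M]
  show "J_bracket J X Y \<in> vector_fields A"
    if "X \<in> vector_fields A" "Y \<in> vector_fields A" for X Y
    unfolding J_bracket_def
    by (intro vector_fields_diff[OF M] vector_fields_add[OF M] lv Jf that)
  show "J_bracket J Z (X + Y) = J_bracket J Z X + J_bracket J Z Y"
    if "X \<in> vector_fields A" "Y \<in> vector_fields A" "Z \<in> vector_fields A" for X Y Z
    using that by (simp add: J_bracket_def lie_bracket_add(2)[OF M] Jadd Jf lv)
  show "J_bracket J X Y = - J_bracket J Y X"
    if "X \<in> vector_fields A" "Y \<in> vector_fields A" for X Y
  proof -
    have "map_field J (lie_bracket X Y) = - map_field J (lie_bracket Y X)"
      using Jsc[OF lv[OF that(2,1)], of "\<lambda>_. -1"]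
      by (simp add: minus_eq_fscale[symmetric] lie_bracket_skew[of X Y])
    then show ?thesis
      unfolding J_bracket_def
      using lie_bracket_skew[of "map_field J X" Y] lie_bracket_skew[of X "map_field J Y"] by simp
  qed
  show "J_bracket J X (fscale f Y) = fscale f (J_bracket J X Y)
      + fscale (apply_field (map_field J X) f) Y"
    if "smooth_fun A f" "X \<in> vector_fields A" "Y \<in> vector_fields A" for f X Y
  proof -
    have "map_field J (lie_bracket X (fscale f Y)) =
        fscale f (map_field J (lie_bracket X Y)) + fscale (apply_field X f) (map_field J Y)"
      using that
      by (simp add: lie_bracket_fscale[OF M] Jadd Jsc lv vector_fields_fscale[OF M] vector_fieldsD)
    with that show ?thesis
      by (simp add: J_bracket_def Jsc lie_bracket_fscale[OF M] Jf)
         (simp add: fscale_def tscale_def fun_eq_iff algebra_simps)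
  qed
qed

lemma levi_civita_unique:
  assumes M: "smooth_manifold A" and g: "riemannian_metric A g"
    and L: "levi_civita A g \<rho> br nab" and L': "levi_civita A g \<rho> br nab'"
    and X: "X \<in> vector_fields A" and Y: "Y \<in> vector_fields A"
  shows "nab X Y = nab' X Y"
proof -
  define B where "B = (\<lambda>X Y. nab X Y - nab' X Y)"
  have cl: "nab U V \<in> vector_fields A" "nab' U V \<in> vector_fields A" "B U V \<in> vector_fields A"
    if "U \<in> vector_fields A" "V \<in> vector_fields A" for U V
    using L L' that vector_fields_diff[OF M]
    by (auto simp: levi_civita_def algebroid_connection_def real_bilinear_op_def B_def)
  have sym: "B U V = B V U" if "U \<in> vector_fields A" "V \<in> vector_fields A" for U V
  proof -
    have "nab U V - nab V U = nab' U V - nab' V U"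
      using L L' that by (simp add: levi_civita_def)
    then show ?thesis by (simp add: B_def algebra_simps)
  qed
  have gadd: "g p (u + v) w = g p u w + g p v w" and gsym: "g p u w = g p w u"
    if "u \<in> tangent_space A p" "v \<in> tangent_space A p" "w \<in> tangent_space A p" for p u v w
    using g that by (auto simp: riemannian_metric_def)
  have gdiff: "g p (u - v) w = g p u w - g p v w"
    if "u \<in> tangent_space A p" "v \<in> tangent_space A p" "w \<in> tangent_space A p" for p u v w
    using gadd[of "u - v" p v w] tangent_diff[OF that(1,2)] that by simp
  have skew: "g p (B U V p) (W p) = - g p (B U W p) (V p)"
    if "U \<in> vector_fields A" "V \<in> vector_fields A" "W \<in> vector_fields A" for p U V W
  proof -
    have "inner_field g (nab U V) W + inner_field g V (nab U W) =
        inner_field g (nab' U V) W + inner_field g V (nab' U W)"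
      using L L' that by (simp add: levi_civita_def)
    then have "g p (nab U V p) (W p) + g p (V p) (nab U W p) =
        g p (nab' U V p) (W p) + g p (V p) (nab' U W p)"
      by (simp add: inner_field_def fun_eq_iff)
    moreover have "g p (V p) (nab U W p) = g p (nab U W p) (V p)"
      "g p (V p) (nab' U W p) = g p (nab' U W p) (V p)"
      using that cl by (auto intro!: gsym vector_fieldsD(1))
    ultimately show ?thesis
      using that cl by (simp add: B_def gdiff vector_fieldsD)
  qed
  have "B X Y p = 0" for p
  proof (rule ccontr)
    define Z where "Z = B X Y"
    have Z: "Z \<in> vector_fields A" using cl X Y by (simp add: Z_def)
    have "g p (B X Y p) (Z p) = - g p (B X Y p) (Z p)"
      using skew[OF X Y Z, of p] sym[OF X Z] skew[OF Z X Y, of p] sym[OF Z Y]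
        skew[OF Y Z X, of p] sym[OF X Y] by simp
    then have "g p (Z p) (Z p) = 0" by (simp add: Z_def)
    moreover assume "B X Y p \<noteq> 0"
    ultimately show False
      using g vector_fieldsD(1)[OF Z, of p] unfolding Z_def riemannian_metric_def
      by (metis less_irrefl)
  qed
  then show ?thesis by (simp add: B_def fun_eq_iff)
qed

end

theory Submission
  imports Defs
begin

text \<open>The symmetric product of a Levi-Civita connection obeys a Koszul formula: adding the
  metric condition for \<open>X\<close> and \<open>Y\<close>, subtracting the one for \<open>Z\<close>, and trading the differences
  \<open>\<nabla>\<^sub>X Z - \<nabla>\<^sub>Z X\<close> and \<open>\<nabla>\<^sub>Y Z - \<nabla>\<^sub>Z Y\<close> for brackets gives
  \<open>g(\<langle>X:Y\<rangle>, Z) = \<rho>X g(Y,Z) + \<rho>Y g(X,Z) - \<rho>Z g(X,Y) - g([X,Z],Y) - g([Y,Z],X)\<close>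
  (lemma \<open>sym_product_koszul\<close>). The right-hand side mentions only anchor, bracket and metric,
  so both sides of the theorem can be compared by pairing them with an arbitrary vector field
  \<open>Z\<close>, which suffices because \<open>g\<close> is definite (lemma \<open>vector_field_eqI\<close>).

  Since \<open>J\<close> is orthogonal with square \<open>-1\<close>, it is skew for \<open>g\<close>. Hence \<open>\<sharp>(V\<^sup>\<flat> \<circ> J) = -JV\<close>
  (lemma \<open>sharp_flat_comp_J\<close>), and pairing this term with \<open>Z\<close> is pairing \<open>V = \<langle>X:Y\<rangle>\<close> with \<open>JZ\<close>.
  Now expand \<open>g(\<langle>JX:Y\<rangle>, Z) + g(\<langle>X:JY\<rangle>, Z) + g(\<langle>X:Y\<rangle>, JZ)\<close> by the Koszul formula of the
  Lie bracket. The derivatives along \<open>X\<close>, \<open>Y\<close> and \<open>Z\<close> cancel in pairs by skewness of \<open>J\<close>, for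
  instance \<open>Y g(JX,Z) + Y g(X,JZ) = 0\<close>. The derivatives along \<open>JX\<close>, \<open>JY\<close> and \<open>JZ\<close> remain,
  which are those of the algebroid with anchor \<open>J\<close>, and the bracket terms
  \<open>g([JX,Z],Y) + g([X,JZ],Y) + g([X,Z],JY)\<close> add up to \<open>g(\<lbrakk>X,Z\<rbrakk>\<^sup>J, Y)\<close>, likewise with \<open>X\<close> and \<open>Y\<close>
  exchanged. This is the Koszul formula for \<open>\<nabla>\<^bsup>J,g\<^esup>\<close>.\<close>

lemma inner_field_add_left:
  assumes "riemannian_metric A g"
    and "X \<in> vector_fields A" "Y \<in> vector_fields A" "Z \<in> vector_fields A"
  shows "inner_field g (X + Y) Z = inner_field g X Z + inner_field g Y Z"
  using assms by (simp add: riemannian_metric_def inner_field_def fun_eq_iff vector_fieldsD)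

lemma inner_field_minus_left:
  assumes "riemannian_metric A g" and "X \<in> vector_fields A" "Z \<in> vector_fields A"
  shows "inner_field g (- X) Z = - inner_field g X Z"
  using assms
  by (simp add: riemannian_metric_def inner_field_def fun_eq_iff vector_fieldsD minus_eq_tscale)

lemma inner_field_diff_left:
  assumes "smooth_manifold A" "riemannian_metric A g"
    and "X \<in> vector_fields A" "Y \<in> vector_fields A" "Z \<in> vector_fields A"
  shows "inner_field g (X - Y) Z = inner_field g X Z - inner_field g Y Z"
  using inner_field_add_left[OF assms(2,3) vector_fields_minus[OF assms(1,4)] assms(5)]
    inner_field_minus_left[OF assms(2,4,5)] by simp

lemma inner_field_commute:
  assumes "riemannian_metric A g" and "X \<in> vector_fields A" "Y \<in> vector_fields A"
  shows "inner_field g X Y = inner_field g Y X"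
  using assms by (simp add: riemannian_metric_def inner_field_def fun_eq_iff vector_fieldsD)

lemma apply_field_uminus:
  assumes "X \<in> vector_fields A" "smooth_fun A f"
  shows "apply_field X (- f) = - apply_field X f"
  using apply_field_simps(2)[OF assms, of "-1"] by (simp add: fun_Compl_def)

text \<open>Positivity applied to \<open>v - w\<close>, which is orthogonal to itself.\<close>

lemma tangent_eqI:
  assumes g: "riemannian_metric A g"
    and v: "v \<in> tangent_space A p" and w: "w \<in> tangent_space A p"
    and eq: "g p v (v - w) = g p w (v - w)"
  shows "v = w"
proof (rule ccontr)
  assume "v \<noteq> w"
  then have "g p (v - w) (v - w) > 0"
    using g tangent_diff[OF v w] by (simp add: riemannian_metric_def)
  moreover have "g p ((v - w) + w) (v - w) = g p (v - w) (v - w) + g p w (v - w)"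
    using g v w tangent_diff[OF v w] unfolding riemannian_metric_def by blast
  ultimately show False using eq by simp
qed

text \<open>The single test field \<open>Z = V - W\<close> separates \<open>V\<close> from \<open>W\<close> at all points at once.\<close>

lemma vector_field_eqI:
  assumes M: "smooth_manifold A" and g: "riemannian_metric A g"
    and V: "V \<in> vector_fields A" and W: "W \<in> vector_fields A"
    and eq: "\<And>Z. Z \<in> vector_fields A \<Longrightarrow> inner_field g V Z = inner_field g W Z"
  shows "V = W"
proof
  fix p
  show "V p = W p"
    using fun_cong[OF eq[OF vector_fields_diff[OF M V W]], of p]
    by (intro tangent_eqI[OF g, of _ p])
       (simp_all add: inner_field_def vector_fieldsD(1)[OF V] vector_fieldsD(1)[OF W])
qed

lemma sharp_eqI:
  assumes g: "riemannian_metric A g" and V: "V \<in> vector_fields A"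
    and eq: "\<And>p w. w \<in> tangent_space A p \<Longrightarrow> g p (V p) w = \<omega> p w"
  shows "sharp A g \<omega> = V"
proof
  fix p
  show "sharp A g \<omega> p = V p"
    unfolding sharp_def
  proof (rule the_equality)
    show "V p \<in> tangent_space A p \<and> (\<forall>w\<in>tangent_space A p. g p (V p) w = \<omega> p w)"
      using eq vector_fieldsD(1)[OF V] by blast
    fix v assume v: "v \<in> tangent_space A p \<and> (\<forall>w\<in>tangent_space A p. g p v w = \<omega> p w)"
    then have "v - V p \<in> tangent_space A p" by (blast intro: tangent_diff vector_fieldsD(1)[OF V])
    then show "v = V p"
      using v eq by (intro tangent_eqI[OF g _ vector_fieldsD(1)[OF V]]) auto
  qed
qed

lemma hermitian_J_skew:
  assumes H: "almost_hermitian_manifold n A g J"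
    and v: "v \<in> tangent_space A p" and w: "w \<in> tangent_space A p"
  shows "g p (J p v) w = - g p v (J p w)"
proof -
  have Jv: "J p v \<in> tangent_space A p" and Jw: "J p w \<in> tangent_space A p"
    using H v w by (auto simp: almost_hermitian_manifold_def almost_complex_def bundle_endo_def)
  have "g p (J p v) w = g p (J p (J p v)) (J p w)"
    using H Jv w by (simp add: almost_hermitian_manifold_def)
  also have "\<dots> = g p (tscale (-1) v) (J p w)"
    using H v by (simp add: almost_hermitian_manifold_def almost_complex_def minus_eq_tscale)
  also have "\<dots> = - g p v (J p w)"
    using H v Jw by (simp add: almost_hermitian_manifold_def riemannian_metric_def)
  finally show ?thesis .
qed

lemma inner_field_J_skew:
  assumes "almost_hermitian_manifold n A g J"
    and "X \<in> vector_fields A" "Y \<in> vector_fields A"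
  shows "inner_field g (map_field J X) Y = - inner_field g X (map_field J Y)"
  using hermitian_J_skew[OF assms(1) vector_fieldsD(1)[OF assms(2)] vector_fieldsD(1)[OF assms(3)]]
  by (simp add: inner_field_def map_field_def fun_eq_iff)

text \<open>By skewness of \<open>J\<close>, \<open>g(V, Jw) = g(-JV, w)\<close>; so the field \<open>-JV\<close> is an explicit Riesz
  representative of \<open>V\<^sup>\<flat> \<circ> J\<close>.\<close>

lemma sharp_flat_comp_J:
  assumes H: "almost_hermitian_manifold n A g J" and V: "V \<in> vector_fields A"
  shows "sharp A g (form_comp (flat g V) J) = - map_field J V"
proof (rule sharp_eqI)
  have JV: "map_field J V \<in> vector_fields A"
    using H V by (simp add: almost_hermitian_manifold_def almost_complex_def bundle_endo_def)
  show g: "riemannian_metric A g" and "- map_field J V \<in> vector_fields A"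
    using H vector_fields_minus[OF _ JV] by (simp_all add: almost_hermitian_manifold_def)
  show "g p ((- map_field J V) p) w = form_comp (flat g V) J p w"
    if w: "w \<in> tangent_space A p" for p w
  proof -
    have "g p (- map_field J V p) w = - g p (map_field J V p) w"
      unfolding minus_eq_tscale
      using g vector_fieldsD(1)[OF JV, of p] w by (simp add: riemannian_metric_def)
    also have "\<dots> = g p (V p) (J p w)"
      unfolding map_field_def
      by (subst hermitian_J_skew[OF H vector_fieldsD(1)[OF V] w]) simp
    finally show ?thesis by (simp add: form_comp_def flat_def)
  qed
qed

lemma levi_civita_vector_fields:
  assumes "levi_civita A g \<rho> br nab" "X \<in> vector_fields A" "Y \<in> vector_fields A"
  shows "nab X Y \<in> vector_fields A"
  using assms by (simp add: levi_civita_def algebroid_connection_def real_bilinear_op_def)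

lemma sym_product_vector_fields:
  assumes "smooth_manifold A" "levi_civita A g \<rho> br nab"
    "X \<in> vector_fields A" "Y \<in> vector_fields A"
  shows "sym_product nab X Y \<in> vector_fields A"
  unfolding sym_product_def
  by (rule vector_fields_add[OF assms(1) levi_civita_vector_fields[OF assms(2-4)]
        levi_civita_vector_fields[OF assms(2,4,3)]])

text \<open>In the usual Koszul formula, the term \<open>g([X,Y],Z)\<close> is the contribution of the
  skew part of \<open>\<nabla>\<close>; symmetrizing in \<open>X\<close> and \<open>Y\<close> removes it.\<close>

lemma sym_product_koszul:
  assumes M: "smooth_manifold A" and g: "riemannian_metric A g"
    and L: "levi_civita A g \<rho> br nab"
    and X: "X \<in> vector_fields A" and Y: "Y \<in> vector_fields A" and Z: "Z \<in> vector_fields A"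
  shows "inner_field g (sym_product nab X Y) Z =
      apply_field (map_field \<rho> X) (inner_field g Y Z)
      + apply_field (map_field \<rho> Y) (inner_field g X Z)
      - apply_field (map_field \<rho> Z) (inner_field g X Y)
      - inner_field g (br X Z) Y - inner_field g (br Y Z) X"
proof -
  note cl = levi_civita_vector_fields[OF L]
  have compat: "apply_field (map_field \<rho> U) (inner_field g V W) =
      inner_field g (nab U V) W + inner_field g (nab U W) V"
    if "U \<in> vector_fields A" "V \<in> vector_fields A" "W \<in> vector_fields A" for U V W
    using L that inner_field_commute[OF g that(2) cl[OF that(1,3)]]
    by (simp add: levi_civita_def)
  have torsion: "inner_field g (br U V) W = inner_field g (nab U V) W - inner_field g (nab V U) W"
    if "U \<in> vector_fields A" "V \<in> vector_fields A" "W \<in> vector_fields A" for U V W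
  proof -
    have "br U V = nab U V - nab V U" using L that by (simp add: levi_civita_def)
    then show ?thesis using that by (simp add: inner_field_diff_left[OF M g] cl)
  qed
  show ?thesis
    using X Y Z
    by (simp add: sym_product_def inner_field_add_left[OF g] cl compat torsion algebra_simps)
qed

text \<open>Moving \<open>J\<close> off \<open>[X,Z]\<close> onto \<open>Y\<close> turns the third term of \<open>\<lbrakk>X,Z\<rbrakk>\<^sup>J\<close> into the bracket term
  that the Koszul formula of \<open>\<langle>X:JY\<rangle>\<close> produces.\<close>

lemma inner_field_J_bracket:
  assumes H: "almost_hermitian_manifold n A g J"
    and X: "X \<in> vector_fields A" and Z: "Z \<in> vector_fields A" and Y: "Y \<in> vector_fields A"
  shows "inner_field g (J_bracket J X Z) Y =
      inner_field g (lie_bracket (map_field J X) Z) Y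
      + inner_field g (lie_bracket X (map_field J Z)) Y
      + inner_field g (lie_bracket X Z) (map_field J Y)"
proof -
  have M: "smooth_manifold A" and g: "riemannian_metric A g"
    and J: "\<And>V. V \<in> vector_fields A \<Longrightarrow> map_field J V \<in> vector_fields A"
    using H by (auto simp: almost_hermitian_manifold_def almost_complex_def bundle_endo_def)
  show ?thesis
    using X Y Z
    by (simp add: J_bracket_def inner_field_diff_left[OF M g] inner_field_add_left[OF g]
        inner_field_J_skew[OF H] lie_bracket_vector_fields[OF M] vector_fields_add[OF M] J)
qed

theorem theorem6p1:
  fixes n :: nat
    and A :: "('a::{t2_space, second_countable_topology}, 'n::finite) atlas"
    and g :: "'a metric_tensor"
    and J :: "'a bundle_map"
    and nab nabJ :: "'a field_op"
    and X Y :: "'a vfield"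
  assumes "almost_hermitian_manifold n A g J"
    and "levi_civita A g id_anchor lie_bracket nab"
    and "levi_civita A g J (J_bracket J) nabJ"
    and "X \<in> vector_fields A" and "Y \<in> vector_fields A"
  shows "sym_product nabJ X Y =
           sym_product nab (map_field J X) Y + sym_product nab X (map_field J Y)
           + sharp A g (form_comp (flat g (sym_product nab X Y)) J)"
proof -
  note H = assms(1) and L = assms(2) and LJ = assms(3) and X = assms(4) and Y = assms(5)
  have M: "smooth_manifold A" and g: "riemannian_metric A g"
    and J: "\<And>V. V \<in> vector_fields A \<Longrightarrow> map_field J V \<in> vector_fields A"
    using H by (auto simp: almost_hermitian_manifold_def almost_complex_def bundle_endo_def)
  have id: "map_field id_anchor V = V" for V :: "'a vfield"
    by (simp add: map_field_def id_anchor_def)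
  note sym_in = sym_product_vector_fields[OF M L]
  note koszul = sym_product_koszul[OF M g L, unfolded id]
  have smooth: "smooth_fun A (inner_field g V W)"
    if "V \<in> vector_fields A" "W \<in> vector_fields A" for V W
    using g that by (simp add: riemannian_metric_def)
  \<comment> \<open>Oriented to move every \<open>J\<close> into the second argument, so that terms which cancel become
    syntactically opposite.\<close>
  have D_skew: "apply_field U (inner_field g (map_field J V) W) =
      - apply_field U (inner_field g V (map_field J W))"
    if "U \<in> vector_fields A" "V \<in> vector_fields A" "W \<in> vector_fields A" for U V W
    using that by (simp add: inner_field_J_skew[OF H] apply_field_uminus smooth J)
  have "sym_product nabJ X Y =
      sym_product nab (map_field J X) Y + sym_product nab X (map_field J Y)
      + - map_field J (sym_product nab X Y)" (is "_ = ?R")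
  proof (rule vector_field_eqI[OF M g])
    show "sym_product nabJ X Y \<in> vector_fields A"
      by (rule sym_product_vector_fields[OF M LJ X Y])
    show "?R \<in> vector_fields A"
      by (intro vector_fields_add[OF M] vector_fields_minus[OF M] sym_in J X Y)
    fix Z assume Z: "Z \<in> vector_fields A"
    have "inner_field g ?R Z = inner_field g (sym_product nab (map_field J X) Y) Z
        + inner_field g (sym_product nab X (map_field J Y)) Z
        + inner_field g (sym_product nab X Y) (map_field J Z)"
      using X Y Z
      by (simp add: inner_field_add_left[OF g] inner_field_minus_left[OF g]
          inner_field_J_skew[OF H] sym_in J vector_fields_add[OF M] vector_fields_minus[OF M]
          del: add_uminus_conv_diff)
    also have "\<dots> = apply_field (map_field J X) (inner_field g Y Z)
        + apply_field (map_field J Y) (inner_field g X Z)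
        - apply_field (map_field J Z) (inner_field g X Y)
        - inner_field g (J_bracket J X Z) Y - inner_field g (J_bracket J Y Z) X"
      using X Y Z
      by (simp add: koszul J D_skew inner_field_J_bracket[OF H] algebra_simps)
    also have "\<dots> = inner_field g (sym_product nabJ X Y) Z"
      by (rule sym_product_koszul[OF M g LJ X Y Z, symmetric])
    finally show "inner_field g (sym_product nabJ X Y) Z = inner_field g ?R Z" by (rule sym)
  qed
  then show ?thesis
    by (simp only: sharp_flat_comp_J[OF H sym_in[OF X Y]])
qed

end
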